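(* Let $r\ge 4$ be a fixed integer, let $0<c<1$ be a real number, and let $\Delta=cn$. If the function $A_{r-2}(\cdot)$ is continuous at $c$, then $$\lim_{n\to\infty}\frac{ssat^{\Delta}(n,K_r)}{n}=A_{r-2}(c).$$
   Context: All graphs are finite and simple. A graph $G$ is $F$-semi-saturated if for every nonedge $e$ of $G$, the graph $G+e$ contains a copy of $F$ that is not contained in $G$ (a new copy of $F$). $ssat^{\Delta}(n,F)$ is the minimum number of edges of an $F$-semi-saturated graph $G$ on $n$ vertices with maximum degree $\Delta(G)\le\Delta$ (it is $\infty$ if no such graph exists); here $\Delta$ may be any real number. A hypergraph $\mathcal{H}=\{H_1,\ldots,H_m\}$ on a finite vertex set $V$ is a family of nonempty subsets of $V$ (its hyperedges). It is $k$-intersecting if $|H\cap H'|\ge k$ for all distinct $H,H'\in\mathcal{H}$. Its fractional matching number $\nu^*(\mathcal{H})$ is the maximum of $\sum_{i=1}^m f_i$ over all $f_1,\ldots,f_m\ge 0$ with $\sum_{i:x\in H_i} f_i\le 1$ for every $x\in V$. For a real $c>0$, $a(\mathcal{H},c)$ is the minimum of $\sum_{i=1}^m |H_i|\,y_i$ over all $(y_1,\ldots,y_m)$ with $y_i\ge 0$ for all $i$, $\sum_{i=1}^m y_i=1$, and $\sum_{i:x\in H_i} y_i\le c$ for every $x\in V$; this linear program is feasible if and only if $c\ge 1/\nu^*(\mathcal{H})$. For a positive integer $k$ and real $c>0$, $$A_k(c)=\inf\{a(\mathcal{H},c): \mathcal{H}\text{ is a } k\text{-intersecting hypergraph with } 1/\nu^*(\mathcal{H})\le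 c\}.$$ *)

theory Defs
  imports Complex_Main "HOL-Library.Extended_Real"
begin

section \<open>Finite simple graphs and semi-saturation\<close>

type_synonym 'a graph = "'a set \<times> 'a set set"

abbreviation verts :: "'a graph \<Rightarrow> 'a set" where "verts \<equiv> fst"
abbreviation edges :: "'a graph \<Rightarrow> 'a set set" where "edges \<equiv> snd"

definition all_pairs :: "'a set \<Rightarrow> 'a set set" where
  "all_pairs V = {e. e \<subseteq> V \<and> card e = 2}"

definition simple_graph :: "'a graph \<Rightarrow> bool" where
  "simple_graph G \<longleftrightarrow> finite (verts G) \<and> edges G \<subseteq> all_pairs (verts G)"

definition nonedges :: "'a graph \<Rightarrow> 'a set set" where
  "nonedges G = all_pairs (verts G) - edges G"

definition add_edge :: "'a graph \<Rightarrow> 'a set \<Rightarrow> 'a graph" where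
  "add_edge G e = (verts G, insert e (edges G))"

definition degree :: "'a graph \<Rightarrow> 'a \<Rightarrow> nat" where
  "degree G v = card {e \<in> edges G. v \<in> e}"

text \<open>The inserted \<open>0\<close> only matters for the graph without vertices.\<close>
definition max_degree :: "'a graph \<Rightarrow> nat" where
  "max_degree G = Max (insert 0 (degree G ` verts G))"

definition complete_graph :: "nat \<Rightarrow> nat graph" where
  "complete_graph r = ({..<r}, all_pairs {..<r})"

definition subgraph :: "'a graph \<Rightarrow> 'a graph \<Rightarrow> bool" where
  "subgraph H G \<longleftrightarrow> verts H \<subseteq> verts G \<and> edges H \<subseteq> edges G"

definition isomorphic :: "'a graph \<Rightarrow> 'b graph \<Rightarrow> bool" where
  "isomorphic F H \<longleftrightarrow>
     (\<exists>f. bij_betw f (verts F) (verts H) \<and> edges H = (\<lambda>e. f ` e) ` edges F)"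

text \<open>A copy of \<open>F\<close> in a graph is a (not necessarily induced) subgraph isomorphic to \<open>F\<close>.\<close>
definition semi_saturated :: "'b graph \<Rightarrow> 'a graph \<Rightarrow> bool" where
  "semi_saturated F G \<longleftrightarrow>
     (\<forall>e \<in> nonedges G. \<exists>H. isomorphic F H \<and> subgraph H (add_edge G e) \<and> \<not> subgraph H G)"

text \<open>
  Every finite graph is isomorphic to one with vertices in \<open>nat\<close>. A nonempty set of type
  \<open>enat\<close> contains its infimum, so this is a minimum, and the infimum of the empty set is \<open>\<infinity>\<close>.
\<close>
definition ssat :: "real \<Rightarrow> nat \<Rightarrow> 'b graph \<Rightarrow> enat" where
  "ssat \<Delta> n F = Inf {enat (card (edges G)) | G :: nat graph.
     simple_graph G \<and> card (verts G) = n \<and> real (max_degree G) \<le> \<Delta> \<and> semi_saturated F G}"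

section \<open>Hypergraphs and the function \<open>A\<close>\<close>

definition hypergraph :: "'a set \<Rightarrow> 'a set set \<Rightarrow> bool" where
  "hypergraph V \<H> \<longleftrightarrow> finite V \<and> (\<forall>H \<in> \<H>. H \<subseteq> V \<and> H \<noteq> {})"

definition k_intersecting :: "nat \<Rightarrow> 'a set set \<Rightarrow> bool" where
  "k_intersecting k \<H> \<longleftrightarrow> (\<forall>H \<in> \<H>. \<forall>H' \<in> \<H>. H \<noteq> H' \<longrightarrow> k \<le> card (H \<inter> H'))"

definition fractional_matching :: "'a set \<Rightarrow> 'a set set \<Rightarrow> ('a set \<Rightarrow> real) \<Rightarrow> bool" where
  "fractional_matching V \<H> f \<longleftrightarrow>
     (\<forall>H \<in> \<H>. 0 \<le> f H) \<and> (\<forall>x \<in> V. (\<Sum>H \<in> {H \<in> \<H>. x \<in> H}. f H) \<le> 1)"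

text \<open>
  For a hypergraph both linear programs below have a compact feasible region (hyperedges are
  nonempty), so the supremum is a maximum, and the infimum is a minimum whenever the program is
  feasible. Extended reals give the value \<open>\<infinity>\<close> to an infeasible minimization, and
  \<open>1 / 0 = \<infinity>\<close> for the reciprocal matching number of the hypergraph without hyperedges.
\<close>
definition frac_matching_number :: "'a set \<Rightarrow> 'a set set \<Rightarrow> ereal" where
  "frac_matching_number V \<H> =
     Sup {ereal (\<Sum>H \<in> \<H>. f H) | f. fractional_matching V \<H> f}"

definition feasible_weights :: "'a set \<Rightarrow> 'a set set \<Rightarrow> real \<Rightarrow> ('a set \<Rightarrow> real) \<Rightarrow> bool" where
  "feasible_weights V \<H> c y \<longleftrightarrow>
     (\<forall>H \<in> \<H>. 0 \<le> y H) \<and> (\<Sum>H \<in> \<H>. y H) = 1 \<and>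
     (\<forall>x \<in> V. (\<Sum>H \<in> {H \<in> \<H>. x \<in> H}. y H) \<le> c)"

definition a_min :: "'a set \<Rightarrow> 'a set set \<Rightarrow> real \<Rightarrow> ereal" where
  "a_min V \<H> c = Inf {ereal (\<Sum>H \<in> \<H>. real (card H) * y H) | y. feasible_weights V \<H> c y}"

text \<open>As for graphs, hypergraphs with vertices in \<open>nat\<close> represent all finite ones.\<close>
definition A_fun :: "nat \<Rightarrow> real \<Rightarrow> ereal" where
  "A_fun k c = Inf {a_min V \<H> c | (V :: nat set) \<H>.
     hypergraph V \<H> \<and> k_intersecting k \<H> \<and> 1 / frac_matching_number V \<H> \<le> ereal c}"

end

theory Submission imports Defs begin

text \<open>
  Write \<open>k = r - 2\<close>. A graph is \<open>K\<^sub>r\<close>-semi-saturated exactly when any two nonadjacent vertices have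
  a clique of size \<open>k\<close> among their common neighbours. With linearly many edges, almost all vertices
  have bounded degree, and a typical pair of them meets in vertices of linear degree only, of which
  there are boundedly many. The traces of the neighbourhoods on those vertices are then a
  \<open>k\<close>-intersecting hypergraph, weighted by frequency: the degree bound \<open>c * n\<close> becomes
  feasibility for \<open>c\<close>, and the number of edges per vertex becomes the objective value.

  \<^emph>\<open>Upper bound\<close> (\<open>blow_up_of_clique\<close>, \<open>ssat_upper_bound\<close>). From a \<open>k\<close>-intersecting hypergraph with
  weights \<open>y\<close> one gets a graph by making the ground set a clique and attaching about \<open>y H * n\<close>
  independent vertices to each hyperedge \<open>H\<close>. Its edges number \<open>n\<close> times the cost of \<open>y\<close>, up to
  a constant. The degrees may exceed the bound by a constant, so the construction is applied with some
  \<open>c' < c\<close>, and continuity of \<open>A_fun k\<close> from the left recovers the value at \<open>c\<close>.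

  \<^emph>\<open>Lower bound\<close> (\<open>A_fun_le_of_sparse_graph\<close>, \<open>ssat_lower_bound\<close>). Given a graph with at most \<open>M * n\<close>
  edges, degrees are divided into huge, medium and small ones by two thresholds, both linear in \<open>n\<close>.
  Two traces on the huge vertices that both occur often must share \<open>k\<close> elements, because one
  can pick a pair of vertices with these traces that is nonadjacent and has no common neighbour of
  small degree. Vertices with a rare trace can be discarded if the lower threshold is tiny in terms
  of the number of traces, which the upper threshold bounds; vertices with a neighbour of medium
  degree can be discarded if the medium degrees have a small sum. Both hold for a suitable pair
  of consecutive terms in a rapidly decreasing sequence of thresholds
  (\<open>scale_with_small_degree_sum\<close>). Discarding a proportion \<open>3 * \<eta>\<close> of the vertices raises \<open>c\<close> to
  \<open>c / (1 - 3 * \<eta>)\<close>, and continuity of \<open>A_fun k\<close> from the right lets \<open>\<eta>\<close> tend to \<open>0\<close>.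
\<close>

section \<open>Neighbourhoods and degrees\<close>

definition nbrs :: "'a graph \<Rightarrow> 'a \<Rightarrow> 'a set" where
  "nbrs G v = {u. {u, v} \<in> edges G}"

lemma all_pairs_iff: "{a, b} \<in> all_pairs V \<longleftrightarrow> a \<in> V \<and> b \<in> V \<and> a \<noteq> b"
  by (auto simp: all_pairs_def card_insert_if)

lemma all_pairsE:
  assumes "e \<in> all_pairs V"
  obtains a b where "e = {a, b}" "a \<in> V" "b \<in> V" "a \<noteq> b"
  using assms unfolding all_pairs_def by (auto simp: card_2_iff)

lemma finite_all_pairs: "finite V \<Longrightarrow> finite (all_pairs V)"
  unfolding all_pairs_def by (rule finite_subset[of _ "Pow V"]) auto

lemma finite_edges: "simple_graph G \<Longrightarrow> finite (edges G)"
  unfolding simple_graph_def using finite_all_pairs finite_subset by blast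

lemma nbrs_subset: "simple_graph G \<Longrightarrow> nbrs G v \<subseteq> verts G - {v}"
  unfolding simple_graph_def nbrs_def using all_pairs_iff[of _ v "verts G"] by blast

lemma finite_nbrs: "simple_graph G \<Longrightarrow> finite (nbrs G v)"
  using nbrs_subset[of G v] finite_subset unfolding simple_graph_def by blast

lemma nbrs_sym: "u \<in> nbrs G v \<longleftrightarrow> v \<in> nbrs G u"
  by (simp add: nbrs_def insert_commute)

lemma degree_eq_card_nbrs:
  assumes "simple_graph G"
  shows "degree G v = card (nbrs G v)"
proof -
  have "bij_betw (\<lambda>u. {u, v}) (nbrs G v) {e \<in> edges G. v \<in> e}"
  proof (rule bij_betw_imageI)
    show "inj_on (\<lambda>u. {u, v}) (nbrs G v)"
      by (auto simp: inj_on_def doubleton_eq_iff)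
    show "(\<lambda>u. {u, v}) ` nbrs G v = {e \<in> edges G. v \<in> e}"
    proof (intro subset_antisym subsetI)
      fix e assume e: "e \<in> {e \<in> edges G. v \<in> e}"
      then have "e \<in> all_pairs (verts G)" using assms unfolding simple_graph_def by auto
      then obtain a b where "e = {a, b}" by (rule all_pairsE)
      with e show "e \<in> (\<lambda>u. {u, v}) ` nbrs G v"
        by (auto simp: nbrs_def insert_commute)
    qed (auto simp: nbrs_def)
  qed
  then show ?thesis unfolding degree_def using bij_betw_same_card by fastforce
qed

lemma handshake:
  assumes "simple_graph G"
  shows "(\<Sum>v\<in>verts G. degree G v) = 2 * card (edges G)"
proof -
  have fin: "finite (verts G)" "finite (edges G)"
    using assms finite_edges[OF assms] by (auto simp: simple_graph_def)
  have "(\<Sum>v\<in>verts G. degree G v) = (\<Sum>v\<in>verts G. \<Sum>e\<in>edges G. if v \<in> e then 1 else 0)"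
    unfolding degree_def using fin by (simp add: sum.If_cases Int_def)
  also have "\<dots> = (\<Sum>e\<in>edges G. \<Sum>v\<in>verts G. if v \<in> e then 1 else 0)"
    by (rule sum.swap)
  also have "\<dots> = (\<Sum>e\<in>edges G. 2)"
  proof (rule sum.cong)
    fix e assume "e \<in> edges G"
    then have "e \<subseteq> verts G" "card e = 2"
      using assms unfolding simple_graph_def all_pairs_def by auto
    then show "(\<Sum>v\<in>verts G. if v \<in> e then 1 else 0) = (2::nat)"
      using fin by (simp add: sum.If_cases Int_absorb1)
  qed simp
  finally show ?thesis by simp
qed

lemma degree_le_max_degree: "simple_graph G \<Longrightarrow> v \<in> verts G \<Longrightarrow> degree G v \<le> max_degree G"
  unfolding max_degree_def simple_graph_def by (auto intro!: Max_ge)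

lemma few_of_large_degree:
  assumes G: "simple_graph G" and e: "real (card (edges G)) \<le> M" and d: "0 < d"
  shows "real (card {v \<in> verts G. d \<le> real (degree G v)}) \<le> 2 * M / d"
proof -
  let ?B = "{v \<in> verts G. d \<le> real (degree G v)}"
  have fin: "finite (verts G)" using G by (simp add: simple_graph_def)
  have "real (card ?B) * d = (\<Sum>v\<in>?B. d)" by simp
  also have "\<dots> \<le> (\<Sum>v\<in>?B. real (degree G v))" by (rule sum_mono) auto
  also have "\<dots> \<le> (\<Sum>v\<in>verts G. real (degree G v))" by (rule sum_mono2) (use fin in auto)
  also have "\<dots> = real (2 * card (edges G))" by (simp flip: handshake[OF G] of_nat_sum)
  finally show ?thesis using e d by (simp add: field_simps)
qed

section \<open>Semi-saturation through common neighbours\<close>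

text \<open>
  The new copy of \<open>K\<^sub>r\<close> must use the added edge \<open>{u, v}\<close>; its other \<open>r - 2\<close> vertices
  are then joined to \<open>u\<close> and to \<open>v\<close> by old edges.
\<close>
lemma common_nbrs_of_semi_saturated:
  assumes G: "simple_graph G" and sat: "semi_saturated (complete_graph r) G"
    and uv: "u \<in> verts G" "v \<in> verts G" "u \<noteq> v" "u \<notin> nbrs G v"
  shows "r - 2 \<le> card (nbrs G u \<inter> nbrs G v)"
proof -
  have "{u, v} \<in> nonedges G"
    using uv by (auto simp: nonedges_def all_pairs_iff nbrs_def)
  then obtain H where iso: "isomorphic (complete_graph r) H"
    and sub: "subgraph H (add_edge G {u, v})" and new: "\<not> subgraph H G"
    using sat unfolding semi_saturated_def by blast
  obtain f where f: "bij_betw f {..<r} (verts H)"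
    and eH: "edges H = (\<lambda>e. f ` e) ` all_pairs {..<r}"
    using iso unfolding isomorphic_def complete_graph_def by auto
  have cardH: "card (verts H) = r" using f bij_betw_same_card by fastforce
  have complete: "{a, b} \<in> edges H" if "a \<in> verts H" "b \<in> verts H" "a \<noteq> b" for a b
  proof -
    have "a \<in> f ` {..<r}" "b \<in> f ` {..<r}" using that f by (simp_all add: bij_betw_imp_surj_on)
    then obtain i j where "i \<in> {..<r}" "j \<in> {..<r}" "a = f i" "b = f j" by blast
    then have "{i, j} \<in> all_pairs {..<r}" "{a, b} = f ` {i, j}" using that by (auto simp: all_pairs_iff)
    then show ?thesis unfolding eH by blast
  qed
  have within: "e \<subseteq> verts H" if "e \<in> edges H" for e
    using that f unfolding eH all_pairs_def bij_betw_def by auto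
  have "{u, v} \<in> edges H"
    using sub new unfolding subgraph_def add_edge_def by auto
  then have uvH: "u \<in> verts H" "v \<in> verts H" using within by auto
  have "verts H - {u, v} \<subseteq> nbrs G u \<inter> nbrs G v"
  proof
    fix x assume x: "x \<in> verts H - {u, v}"
    then have "{x, u} \<in> edges H" "{x, v} \<in> edges H" using complete uvH by auto
    moreover have "{x, u} \<noteq> {u, v}" "{x, v} \<noteq> {u, v}" using x by (auto simp: doubleton_eq_iff)
    ultimately have "{x, u} \<in> edges G" "{x, v} \<in> edges G"
      using sub unfolding subgraph_def add_edge_def by auto
    then show "x \<in> nbrs G u \<inter> nbrs G v" by (auto simp: nbrs_def)
  qed
  then have "card (verts H - {u, v}) \<le> card (nbrs G u \<inter> nbrs G v)"
    using finite_nbrs[OF G] by (intro card_mono) auto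
  moreover have "card (verts H - {u, v}) = r - 2"
    using uvH uv(3) cardH by (simp add: card_Diff_subset)
  ultimately show ?thesis by simp
qed

lemma semi_saturated_completeI:
  assumes G: "simple_graph G" and r: "2 \<le> r"
    and clique: "\<And>u v. u \<in> verts G \<Longrightarrow> v \<in> verts G \<Longrightarrow> u \<noteq> v \<Longrightarrow> u \<notin> nbrs G v \<Longrightarrow>
      \<exists>S. S \<subseteq> nbrs G u \<inter> nbrs G v \<and> card S = r - 2 \<and> all_pairs S \<subseteq> edges G"
  shows "semi_saturated (complete_graph r) G"
  unfolding semi_saturated_def
proof
  fix e assume e: "e \<in> nonedges G"
  then obtain u v where uv: "e = {u, v}" "u \<in> verts G" "v \<in> verts G" "u \<noteq> v"
    unfolding nonedges_def by (auto elim!: all_pairsE)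
  then have "u \<notin> nbrs G v" using e by (auto simp: nonedges_def nbrs_def)
  then obtain S where S: "S \<subseteq> nbrs G u \<inter> nbrs G v" "card S = r - 2" "all_pairs S \<subseteq> edges G"
    using clique[OF uv(2-4)] by blast
  define K where "K = insert u (insert v S)"
  have finS: "finite S" using S(1) finite_subset[OF _ finite_nbrs[OF G, of u]] by simp
  have SG: "S \<subseteq> verts G" "u \<notin> S" "v \<notin> S"
    using S(1) nbrs_subset[OF G, of u] nbrs_subset[OF G, of v] by auto
  have "finite K" "card K = r" using finS SG uv S(2) r by (auto simp: K_def)
  then obtain f where f: "bij_betw f {..<r} K"
    by (metis atLeast0LessThan ex_bij_betw_nat_finite)
  have img: "all_pairs K = (\<lambda>e. f ` e) ` all_pairs {..<r}"
  proof (intro subset_antisym subsetI)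
    fix p assume "p \<in> all_pairs K"
    then obtain a b where ab: "p = {a, b}" "a \<in> K" "b \<in> K" "a \<noteq> b" by (rule all_pairsE)
    then have "a \<in> f ` {..<r}" "b \<in> f ` {..<r}" using f by (simp_all add: bij_betw_imp_surj_on)
    then obtain i j where "i \<in> {..<r}" "j \<in> {..<r}" "a = f i" "b = f j" by blast
    then have "{i, j} \<in> all_pairs {..<r}" "p = f ` {i, j}" using ab by (auto simp: all_pairs_iff)
    then show "p \<in> (\<lambda>e. f ` e) ` all_pairs {..<r}" by blast
  next
    fix p assume "p \<in> (\<lambda>e. f ` e) ` all_pairs {..<r}"
    then obtain q where q: "q \<in> all_pairs {..<r}" "p = f ` q" by blast
    from q(1) obtain i j where ij: "q = {i, j}" "i \<in> {..<r}" "j \<in> {..<r}" "i \<noteq> j" by (rule all_pairsE)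
    then have "f i \<in> K" "f j \<in> K" "f i \<noteq> f j" using f unfolding bij_betw_def inj_on_def by auto
    then show "p \<in> all_pairs K" using q ij by (simp add: all_pairs_iff)
  qed
  have "isomorphic (complete_graph r) (K, all_pairs K)"
    unfolding isomorphic_def complete_graph_def using f img by auto
  moreover have "all_pairs K \<subseteq> insert e (edges G)"
  proof
    fix p assume "p \<in> all_pairs K"
    then obtain a b where ab: "p = {a, b}" "a \<in> K" "b \<in> K" "a \<noteq> b" by (rule all_pairsE)
    have "{a, b} \<in> edges G" if "a \<in> S" "b \<in> S"
      using that ab(4) S(3) all_pairs_iff[of a b S] by blast
    then show "p \<in> insert e (edges G)"
      using ab S(1) uv(1) by (auto simp: K_def nbrs_def insert_commute)
  qed
  then have "subgraph (K, all_pairs K) (add_edge G e)"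
    using SG uv by (auto simp: subgraph_def add_edge_def K_def)
  moreover have "e \<in> all_pairs K" using uv by (simp add: all_pairs_iff K_def)
  then have "\<not> subgraph (K, all_pairs K) G"
    using e by (auto simp: subgraph_def nonedges_def)
  ultimately show "\<exists>H. isomorphic (complete_graph r) H \<and> subgraph H (add_edge G e) \<and> \<not> subgraph H G"
    by blast
qed

section \<open>From weighted hypergraphs to sparse semi-saturated graphs\<close>

text \<open>
  An injection of \<open>W\<close> into the disjoint union of the sets \<open>{..<b i}\<close>, followed by the
  projection to the index.
\<close>
lemma fibres_bounded:
  assumes W: "finite W" and I: "finite I" and le: "card W \<le> sum b I"
  shows "\<exists>\<phi>. \<phi> ` W \<subseteq> I \<and> (\<forall>i\<in>I. card {w \<in> W. \<phi> w = i} \<le> b i)"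
proof -
  let ?S = "SIGMA i:I. {..<b i}"
  have "finite ?S" "card W \<le> card ?S" using I le by auto
  then obtain g where g: "g ` W \<subseteq> ?S" "inj_on g W" using W card_le_inj by metis
  have "card {w \<in> W. fst (g w) = i} \<le> b i" if "i \<in> I" for i
  proof -
    have "g ` {w \<in> W. fst (g w) = i} \<subseteq> {i} \<times> {..<b i}" using g(1) by fastforce
    moreover have "inj_on g {w \<in> W. fst (g w) = i}" using g(2) by (auto simp: inj_on_def)
    ultimately have "card {w \<in> W. fst (g w) = i} \<le> card ({i} \<times> {..<b i})"
      by (intro card_inj_on_le) auto
    then show ?thesis by simp
  qed
  then show ?thesis using g(1) by (intro exI[of _ "fst \<circ> g"]) fastforce
qed

text \<open>
  The extremal construction: a clique on \<open>V\<close>, and independent outer vertices distributed over the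
  hyperedges in proportion to \<open>y\<close>, each joined to the vertices of its hyperedge. As \<open>c < 1\<close>, no
  single hyperedge carries all the weight, hence there are at least two of them and every
  hyperedge itself has at least \<open>k\<close> elements. Two nonadjacent vertices therefore always share
  \<open>k\<close> vertices of the clique \<open>V\<close>. Rounding the class sizes costs an amount independent of \<open>n\<close>.
\<close>
lemma blow_up_of_clique:
  fixes V :: "nat set"
  assumes hyp: "hypergraph V \<H>" and int: "k_intersecting k \<H>"
    and y: "feasible_weights V \<H> c y" and c: "c < 1"
    and n: "card V \<le> n" "real (card V + card \<H>) + c * real n \<le> d" "0 \<le> c"
  shows "\<exists>G :: nat graph. simple_graph G \<and> card (verts G) = n \<and> real (max_degree G) \<le> d \<and>
    semi_saturated (complete_graph (k + 2)) G \<and>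
    real (card (edges G)) \<le> real n * (\<Sum>H\<in>\<H>. real (card H) * y H)
      + (real (card (all_pairs V)) + (\<Sum>H\<in>\<H>. real (card H)))"
proof -
  have finV: "finite V" and HV: "\<And>H. H \<in> \<H> \<Longrightarrow> H \<subseteq> V" and Hne: "\<And>H. H \<in> \<H> \<Longrightarrow> H \<noteq> {}"
    using hyp unfolding hypergraph_def by auto
  have fin\<H>: "finite \<H>" using HV finV by (intro finite_subset[of \<H> "Pow V"]) auto
  have finH: "finite H" if "H \<in> \<H>" for H using that HV finV finite_subset by blast
  have y0: "0 \<le> y H" if "H \<in> \<H>" for H using y that unfolding feasible_weights_def by auto
  have y1: "(\<Sum>H\<in>\<H>. y H) = 1" using y unfolding feasible_weights_def by auto
  have yc: "(\<Sum>H \<in> {H \<in> \<H>. x \<in> H}. y H) \<le> c" if "x \<in> V" for x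
    using y that unfolding feasible_weights_def by auto
  have other: "\<exists>H'\<in>\<H>. H' \<noteq> H" if H: "H \<in> \<H>" for H
  proof (rule ccontr)
    assume "\<not> ?thesis"
    then have eq: "\<H> = {H}" using H by blast
    obtain x where "x \<in> H" using Hne[OF H] by auto
    then have "{H' \<in> \<H>. x \<in> H'} = \<H>" unfolding eq by auto
    moreover have "x \<in> V" using HV[OF H] \<open>x \<in> H\<close> by blast
    ultimately have "(\<Sum>H\<in>\<H>. y H) \<le> c" using yc[of x] by simp
    then show False using y1 c by linarith
  qed
  have k_le: "k \<le> card (H \<inter> H')" if "H \<in> \<H>" "H' \<in> \<H>" for H H'
  proof (cases "H = H'")
    case True
    obtain H'' where "H'' \<in> \<H>" "H'' \<noteq> H" using other[OF \<open>H \<in> \<H>\<close>] by blast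
    then have "k \<le> card (H \<inter> H'')" using int \<open>H \<in> \<H>\<close> unfolding k_intersecting_def by metis
    also have "\<dots> \<le> card H" using finH that by (intro card_mono) auto
    finally show ?thesis using True by simp
  qed (use int that in \<open>auto simp: k_intersecting_def\<close>)
  obtain W where W: "W \<subseteq> - V" "card W = n - card V" "finite W"
    using infinite_arbitrarily_large[of "- V" "n - card V"] finV by (auto simp: Compl_eq_Diff_UNIV)
  have cWn: "card W \<le> n" using W by simp
  \<comment> \<open>Rounding up leaves room for all of \<open>W\<close>; the classes exceed \<open>y H * n\<close> by at most one vertex.\<close>
  define b where "b H = nat \<lceil>y H * real (card W)\<rceil>" for H
  have b_le: "real (b H) \<le> y H * real n + 1" if "H \<in> \<H>" for H
  proof -
    have "0 \<le> y H * real (card W)" using y0 that by simp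
    then have "real (b H) \<le> y H * real (card W) + 1" unfolding b_def by linarith
    moreover have "y H * real (card W) \<le> y H * real n" using cWn y0 that by (intro mult_left_mono) auto
    ultimately show ?thesis by linarith
  qed
  have "real (card W) = (\<Sum>H\<in>\<H>. y H * real (card W))" using y1 by (simp flip: sum_distrib_right)
  also have "\<dots> \<le> (\<Sum>H\<in>\<H>. real (b H))" unfolding b_def by (intro sum_mono) linarith
  finally have "card W \<le> sum b \<H>" by (simp flip: of_nat_sum)
  from fibres_bounded[OF W(3) fin\<H> this]
  obtain \<phi> where \<phi>: "\<phi> ` W \<subseteq> \<H>" "\<forall>H\<in>\<H>. card {w \<in> W. \<phi> w = H} \<le> b H" by (elim exE conjE)
  have \<phi>V: "\<phi> w \<subseteq> V" if "w \<in> W" for w using that \<phi>(1) by (intro HV) blast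
  have \<phi>\<H>: "\<phi> w \<in> \<H>" if "w \<in> W" for w using that \<phi>(1) by blast
  \<comment> \<open>The edges between the outer vertices and the clique.\<close>
  define C where "C = (\<lambda>(w, x). {w, x}) ` (SIGMA w:W. \<phi> w)"
  define G where "G = (V \<union> W, all_pairs V \<union> C)"
  have disj: "V \<inter> W = {}" using W(1) by auto
  have finS: "finite (SIGMA w:W. \<phi> w)" using W(3) \<phi>(1) finH by (intro finite_SigmaI) auto
  have C: "{a, b} \<in> C \<longleftrightarrow> a \<in> W \<and> b \<in> \<phi> a \<or> b \<in> W \<and> a \<in> \<phi> b" for a b
    unfolding C_def by (auto simp: doubleton_eq_iff image_iff)
  have G: "simple_graph G"
    unfolding simple_graph_def
  proof
    show "finite (verts G)" using finV W by (simp add: G_def)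
    show "edges G \<subseteq> all_pairs (verts G)"
      using \<phi>V disj by (fastforce simp: G_def C_def all_pairs_iff all_pairs_def card_insert_if)
  qed
  have nbrV: "nbrs G x = (V - {x}) \<union> {w \<in> W. x \<in> \<phi> w}" if "x \<in> V" for x
    using that disj \<phi>V by (auto simp: nbrs_def G_def C all_pairs_iff)
  have nbrW: "nbrs G w = \<phi> w" if "w \<in> W" for w
    using that disj \<phi>V by (auto simp: nbrs_def G_def C all_pairs_iff)
  have fibre_sum: "(\<Sum>w\<in>W. g (\<phi> w)) = (\<Sum>H\<in>\<H>. g H * real (card {w \<in> W. \<phi> w = H}))" for g :: "nat set \<Rightarrow> real"
  proof -
    have "(\<Sum>w\<in>W. g (\<phi> w)) = (\<Sum>H\<in>\<H>. \<Sum>w\<in>{w \<in> W. \<phi> w = H}. g (\<phi> w))"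
      by (rule sum.group[symmetric]) (use W fin\<H> \<phi> in auto)
    also have "\<dots> = (\<Sum>H\<in>\<H>. g H * real (card {w \<in> W. \<phi> w = H}))"
      by (intro sum.cong) auto
    finally show ?thesis .
  qed
  \<comment> \<open>Used with the indicator of \<open>x \<in> H\<close> to bound degrees, and with \<open>card H\<close> to count edges.\<close>
  have fibre_le: "(\<Sum>w\<in>W. g (\<phi> w)) \<le> real n * (\<Sum>H\<in>\<H>. g H * y H) + (\<Sum>H\<in>\<H>. g H)"
    if "\<And>H. 0 \<le> g H" for g :: "nat set \<Rightarrow> real"
  proof -
    have "(\<Sum>w\<in>W. g (\<phi> w)) \<le> (\<Sum>H\<in>\<H>. g H * (y H * real n + 1))"
      unfolding fibre_sum using \<phi>(2) b_le that
      by (intro sum_mono mult_left_mono) (meson of_nat_le_iff order_trans)+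
    also have "\<dots> = real n * (\<Sum>H\<in>\<H>. g H * y H) + (\<Sum>H\<in>\<H>. g H)"
      by (simp add: algebra_simps sum.distrib sum_distrib_left)
    finally show ?thesis .
  qed
  have degV: "real (degree G x) \<le> d" if x: "x \<in> V" for x
  proof -
    have "real (card {w \<in> W. x \<in> \<phi> w}) = (\<Sum>w\<in>W. if x \<in> \<phi> w then 1 else 0)"
      using W(3) by (simp add: sum.If_cases Int_def)
    also have "\<dots> \<le> real n * (\<Sum>H\<in>\<H>. (if x \<in> H then 1 else 0) * y H) + (\<Sum>H\<in>\<H>. if x \<in> H then 1 else 0)"
      using fibre_le[of "\<lambda>H. if x \<in> H then 1 else 0"] by simp
    also have "(\<Sum>H\<in>\<H>. (if x \<in> H then 1 else 0) * y H) = (\<Sum>H \<in> {H \<in> \<H>. x \<in> H}. y H)"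
      using fin\<H> by (intro sum.mono_neutral_cong_right) auto
    also have "real n * \<dots> \<le> real n * c" using yc[OF x] by (intro mult_left_mono) auto
    also have "(\<Sum>H\<in>\<H>. if x \<in> H then 1 else 0) \<le> (\<Sum>H\<in>\<H>. 1 :: real)" by (intro sum_mono) auto
    finally have 1: "real (card {w \<in> W. x \<in> \<phi> w}) \<le> c * real n + real (card \<H>)"
      by (simp add: mult.commute)
    have "degree G x \<le> card (V - {x}) + card {w \<in> W. x \<in> \<phi> w}"
      unfolding degree_eq_card_nbrs[OF G] nbrV[OF x] by (rule card_Un_le)
    also have "card (V - {x}) \<le> card V" using finV by (intro card_mono) auto
    finally show ?thesis using 1 n(2) by linarith
  qed
  have degW: "real (degree G w) \<le> d" if w: "w \<in> W" for w
  proof -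
    have "degree G w \<le> card V"
      unfolding degree_eq_card_nbrs[OF G] nbrW[OF w] using finV \<phi>V w by (intro card_mono) auto
    moreover have "0 \<le> c * real n" using n(3) by simp
    ultimately show ?thesis using n(2) by linarith
  qed
  have "real (max_degree G) \<le> d"
  proof -
    have "max_degree G \<in> insert 0 (degree G ` verts G)"
      unfolding max_degree_def using G by (intro Max_in) (auto simp: simple_graph_def)
    moreover have "0 \<le> d" using n(2) mult_nonneg_nonneg[OF n(3), of "real n"] by simp
    ultimately show ?thesis using degV degW by (auto simp: G_def)
  qed
  moreover have "semi_saturated (complete_graph (k + 2)) G"
  proof (rule semi_saturated_completeI[OF G])
    fix u v assume uv: "u \<in> verts G" "v \<in> verts G" "u \<noteq> v" "u \<notin> nbrs G v"
    \<comment> \<open>Any \<open>k\<close> common neighbours inside \<open>V\<close> form a clique, because \<open>V\<close> is one.\<close>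
    have pick: "\<exists>S. S \<subseteq> nbrs G u \<inter> nbrs G v \<and> card S = k + 2 - 2 \<and> all_pairs S \<subseteq> edges G"
      if X: "X \<subseteq> nbrs G u \<inter> nbrs G v \<inter> V" "k \<le> card X" for X
    proof -
      obtain S where S: "S \<subseteq> X" "card S = k" using X(2) obtain_subset_with_card_n by metis
      then have "all_pairs S \<subseteq> all_pairs V" using X(1) by (auto simp: all_pairs_def)
      then show ?thesis using S X by (intro exI[of _ S]) (auto simp: G_def)
    qed
    show "\<exists>S. S \<subseteq> nbrs G u \<inter> nbrs G v \<and> card S = k + 2 - 2 \<and> all_pairs S \<subseteq> edges G"
    proof (cases "u \<in> W")
      case u: True
      show ?thesis
      proof (cases "v \<in> W")
        case True
        show ?thesis
          using u True by (intro pick[of "\<phi> u \<inter> \<phi> v"]) (use \<phi>V[OF u] in \<open>auto simp: nbrW intro!: k_le \<phi>\<H>\<close>)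
      next
        case False
        then have v: "v \<in> V" using uv by (auto simp: G_def)
        then have "v \<notin> \<phi> u" using uv(4) u nbrV by auto
        then show ?thesis
          using u v \<phi>V[OF u] k_le[OF \<phi>\<H> \<phi>\<H>, of u u]
          by (intro pick[of "\<phi> u"]) (auto simp: nbrW nbrV)
      qed
    next
      case False
      then have u: "u \<in> V" using uv by (auto simp: G_def)
      then have v: "v \<in> W" using uv nbrV[of v] by (auto simp: G_def)
      then have "u \<notin> \<phi> v" using uv(4) nbrW by auto
      then show ?thesis
        using u v \<phi>V[OF v] k_le[OF \<phi>\<H> \<phi>\<H>, of v v]
        by (intro pick[of "\<phi> v"]) (auto simp: nbrW nbrV)
    qed
  qed simp
  moreover have "card (verts G) = n"
    using n(1) W disj finV by (simp add: G_def card_Un_disjoint)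
  moreover have "real (card (edges G)) \<le> real n * (\<Sum>H\<in>\<H>. real (card H) * y H)
      + (real (card (all_pairs V)) + (\<Sum>H\<in>\<H>. real (card H)))"
  proof -
    have "card C \<le> card (SIGMA w:W. \<phi> w)" unfolding C_def by (rule card_image_le[OF finS])
    also have "\<dots> = (\<Sum>w\<in>W. card (\<phi> w))" using W \<phi> finH by (intro card_SigmaI) auto
    finally have "real (card C) \<le> (\<Sum>w\<in>W. real (card (\<phi> w)))" by (simp flip: of_nat_sum)
    also have "\<dots> \<le> real n * (\<Sum>H\<in>\<H>. real (card H) * y H) + (\<Sum>H\<in>\<H>. real (card H))"
      using fibre_le[of "\<lambda>H. real (card H)"] by simp
    finally show ?thesis using card_Un_le[of "all_pairs V" C] by (simp add: G_def)
  qed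
  ultimately show ?thesis using G by blast
qed

section \<open>From sparse semi-saturated graphs to weighted hypergraphs\<close>

text \<open>
  If \<open>y\<close> is feasible for \<open>c\<close>, then \<open>y / c\<close> is a fractional matching of total weight \<open>1 / c\<close>.
  So the side condition on the matching number in the definition of \<^const>\<open>A_fun\<close> is automatic
  as soon as feasible weights are at hand.
\<close>
lemma A_fun_le_weights:
  fixes V :: "nat set"
  assumes V: "hypergraph V \<H>" "k_intersecting k \<H>" and y: "feasible_weights V \<H> c y" and c: "0 < c"
  shows "A_fun k c \<le> ereal (\<Sum>H\<in>\<H>. real (card H) * y H)"
proof -
  have "fractional_matching V \<H> (\<lambda>H. y H / c)"
    using y c unfolding fractional_matching_def feasible_weights_def
    by (auto simp: divide_le_eq simp flip: sum_divide_distrib)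
  moreover have "(\<Sum>H\<in>\<H>. y H / c) = 1 / c"
    using y unfolding feasible_weights_def by (simp flip: sum_divide_distrib)
  ultimately have nu: "ereal (1 / c) \<le> frac_matching_number V \<H>"
    unfolding frac_matching_number_def by (intro Sup_upper) force
  have "1 / frac_matching_number V \<H> \<le> ereal c"
  proof (cases "frac_matching_number V \<H>")
    case (real x)
    then have "1 / c \<le> x" "0 < x" using nu c
      by (auto intro: less_le_trans[of 0 "1 / c"])
    then show ?thesis using real c by (simp add: field_simps one_ereal_def)
  qed (use nu c in auto)
  then have "A_fun k c \<le> a_min V \<H> c"
    unfolding A_fun_def using V by (intro Inf_lower) blast
  also have "\<dots> \<le> ereal (\<Sum>H\<in>\<H>. real (card H) * y H)"
    unfolding a_min_def using y by (intro Inf_lower) blast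
  finally show ?thesis .
qed

text \<open>
  The traces \<open>nbrs G u \<inter> Huge\<close> of the neighbourhoods of most vertices \<open>u\<close> form a
  \<open>k\<close>-intersecting hypergraph. Vertices of degree above \<open>T\<close>, vertices with a neighbour of medium degree, and
  vertices whose trace occurs at most \<open>D\<close> times are discarded; each kind accounts for at most
  \<open>\<eta> * n\<close> vertices. For a remaining \<open>u\<close>, at most \<open>D\<close> vertices equal \<open>u\<close>, are adjacent to it or
  share with it a neighbour of small degree, so every remaining trace is the trace of a vertex \<open>v\<close>
  outside this exceptional set, and then all the common neighbours of \<open>u\<close> and \<open>v\<close> are huge. The
  weight of a trace is its relative frequency. As the remaining vertices are not huge
  themselves, an edge is counted at most once in the cost, which avoids losing a factor of two.
\<close>
lemma A_fun_le_of_sparse_graph: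
  fixes G :: "nat graph" and c \<eta> M T \<delta> \<delta>' :: real
  defines "n \<equiv> real (card (verts G))"
  assumes G: "simple_graph G"
    and common: "\<And>u v. u \<in> verts G \<Longrightarrow> v \<in> verts G \<Longrightarrow> u \<noteq> v \<Longrightarrow> u \<notin> nbrs G v \<Longrightarrow>
      k \<le> card (nbrs G u \<inter> nbrs G v)"
    and k: "1 \<le> k" and n: "0 < n" and c: "0 < c"
    and deg: "\<And>v. v \<in> verts G \<Longrightarrow> real (degree G v) \<le> c * n"
    and edges: "real (card (edges G)) \<le> M * n" and M: "0 \<le> M"
    and \<eta>: "3 * \<eta> < 1" and T: "0 < T" "2 * M \<le> \<eta> * T" and \<delta>: "0 < \<delta>" "T < \<delta> * n" and \<delta>': "0 < \<delta>'"
    and medium: "(\<Sum>x\<in>{x \<in> verts G. \<delta>' * n \<le> real (degree G x) \<and> real (degree G x) < \<delta> * n}.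
        real (degree G x)) \<le> \<eta> * n"
    and rare: "2 powr (2 * M / \<delta>) * (T * (\<delta>' * n) + T + 1) \<le> \<eta> * n"
  shows "A_fun k (c / (1 - 3 * \<eta>)) \<le> ereal (M / (1 - 3 * \<eta>))"
proof -
  define Huge where "Huge = {x \<in> verts G. \<delta> * n \<le> real (degree G x)}"
  define Med where "Med = {x \<in> verts G. \<delta>' * n \<le> real (degree G x) \<and> real (degree G x) < \<delta> * n}"
  define Low where "Low = {u \<in> verts G. real (degree G u) \<le> T \<and> nbrs G u \<inter> Med = {}}"
  define cls where "cls P = {u \<in> Low. nbrs G u \<inter> Huge = P}" for P
  define D where "D = T * (\<delta>' * n) + T + 1"
  define \<H> where "\<H> = {P. P \<subseteq> Huge \<and> D < real (card (cls P))}"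
  define R where "R = {u \<in> Low. nbrs G u \<inter> Huge \<in> \<H>}"
  have fin: "finite (verts G)" using G by (simp add: simple_graph_def)
  have finHuge: "finite Huge" and finMed: "finite Med" and finLow: "finite Low" and finR: "finite R"
    using fin by (auto simp: Huge_def Med_def Low_def R_def)
  have fin\<H>: "finite \<H>" using finHuge by (intro finite_subset[of \<H> "Pow Huge"]) (auto simp: \<H>_def)
  have fincls: "finite (cls P)" for P using finLow by (auto simp: cls_def)
  have D0: "0 < D" using T \<delta>' n unfolding D_def by (intro add_nonneg_pos) auto
  have cls_R: "cls P = {u \<in> R. nbrs G u \<inter> Huge = P}" if "P \<in> \<H>" for P
    using that by (auto simp: cls_def R_def)

  \<comment> \<open>The case \<open>P = Q\<close> is included; it shows that the traces are nonempty.\<close>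
  have inter: "k \<le> card (P \<inter> Q)" if P: "P \<in> \<H>" and Q: "Q \<in> \<H>" for P Q
  proof -
    have "0 < card (cls P)" using P D0 unfolding \<H>_def by (cases "card (cls P)") auto
    then obtain u where u: "u \<in> cls P" by (auto simp: card_gt_0_iff)
    define S where "S = {x \<in> nbrs G u. real (degree G x) < \<delta>' * n}"
    have degu: "real (card (nbrs G u)) \<le> T"
      using u by (simp add: cls_def Low_def degree_eq_card_nbrs[OF G])
    have finS: "finite S" "card S \<le> card (nbrs G u)"
      using finite_nbrs[OF G] by (auto simp: S_def intro: card_mono)
    have "real (card (\<Union>x\<in>S. nbrs G x)) \<le> (\<Sum>x\<in>S. real (card (nbrs G x)))"
      using card_UN_le[OF finS(1), of "nbrs G"] by (simp flip: of_nat_sum)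
    also have "\<dots> \<le> (\<Sum>x\<in>S. \<delta>' * n)"
      by (intro sum_mono) (auto simp: S_def degree_eq_card_nbrs[OF G])
    also have "\<dots> \<le> T * (\<delta>' * n)"
      using degu finS \<delta>' n by (simp add: mult_right_mono)
    finally have "real (card (\<Union>x\<in>S. nbrs G x)) \<le> T * (\<delta>' * n)" .
    moreover have "card (insert u (nbrs G u \<union> (\<Union>x\<in>S. nbrs G x))) \<le>
        Suc (card (nbrs G u) + card (\<Union>x\<in>S. nbrs G x))"
      using card_Un_le[of "nbrs G u" "\<Union>x\<in>S. nbrs G x"] finS finite_nbrs[OF G]
      by (simp add: card_insert_if)
    ultimately have "real (card (insert u (nbrs G u \<union> (\<Union>x\<in>S. nbrs G x)))) \<le> D"
      using degu unfolding D_def by linarith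
    also have "D < real (card (cls Q))" using Q by (simp add: \<H>_def)
    finally have "\<not> cls Q \<subseteq> insert u (nbrs G u \<union> (\<Union>x\<in>S. nbrs G x))"
      using card_mono[of "insert u (nbrs G u \<union> (\<Union>x\<in>S. nbrs G x))" "cls Q"] finS finite_nbrs[OF G]
      by auto
    then obtain v where v: "v \<in> cls Q" "v \<noteq> u" "v \<notin> nbrs G u" "\<And>x. x \<in> S \<Longrightarrow> v \<notin> nbrs G x"
      by blast
    have "nbrs G u \<inter> nbrs G v \<subseteq> P \<inter> Q"
    proof
      fix x assume x: "x \<in> nbrs G u \<inter> nbrs G v"
      then have "x \<in> verts G" using nbrs_subset[OF G] by blast
      moreover have "x \<notin> Med" using u x by (auto simp: cls_def Low_def)
      moreover have "x \<notin> S" using v(4) x nbrs_sym by fast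
      ultimately have "x \<in> Huge" using x by (auto simp: Huge_def Med_def S_def not_le not_less)
      then show "x \<in> P \<inter> Q" using x u v by (auto simp: cls_def)
    qed
    moreover have "finite (P \<inter> Q)" using P finHuge finite_subset by (auto simp: \<H>_def)
    ultimately have "card (nbrs G u \<inter> nbrs G v) \<le> card (P \<inter> Q)" by (intro card_mono)
    moreover have "k \<le> card (nbrs G v \<inter> nbrs G u)"
      by (rule common) (use u v in \<open>auto simp: cls_def Low_def\<close>)
    ultimately show ?thesis by (simp add: Int_commute)
  qed

  have R_large: "(1 - 3 * \<eta>) * n \<le> real (card R)"
  proof -
    \<comment> \<open>\<open>X\<close>, \<open>Y\<close>, \<open>Z\<close> collect the three kinds of discarded vertices.\<close>
    define X where "X = {u \<in> verts G. T \<le> real (degree G u)}"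
    define Y where "Y = (\<Union>x\<in>Med. nbrs G x)"
    define Z where "Z = (\<Union>P\<in>Pow Huge - \<H>. cls P)"
    have "verts G - R \<subseteq> X \<union> (Y \<union> Z)"
      by (auto simp: X_def Y_def Z_def R_def cls_def Low_def nbrs_sym not_le)
    moreover have "finite (X \<union> (Y \<union> Z))"
      using fin finMed finHuge finite_nbrs[OF G] fincls by (auto simp: X_def Y_def Z_def)
    ultimately have "card (verts G - R) \<le> card (X \<union> (Y \<union> Z))" by (intro card_mono)
    also have "\<dots> \<le> card X + (card Y + card Z)"
      by (meson add_left_mono card_Un_le order_trans)
    finally have split: "card (verts G - R) \<le> card X + (card Y + card Z)" .
    have "real (card X) \<le> 2 * (M * n) / T"
      unfolding X_def by (rule few_of_large_degree[OF G edges T(1)])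
    also have "\<dots> \<le> \<eta> * n"
    proof -
      have "2 * M * n \<le> \<eta> * T * n" using T(2) n by (intro mult_right_mono) auto
      then show ?thesis using T(1) by (simp add: field_simps)
    qed
    finally have X: "real (card X) \<le> \<eta> * n" .
    have "real (card Y) \<le> (\<Sum>x\<in>Med. real (card (nbrs G x)))"
      unfolding Y_def using card_UN_le[OF finMed, of "nbrs G"] by (simp flip: of_nat_sum)
    also have "\<dots> \<le> \<eta> * n" using medium by (simp add: Med_def degree_eq_card_nbrs[OF G])
    finally have Y: "real (card Y) \<le> \<eta> * n" .
    have "real (card Huge) \<le> 2 * (M * n) / (\<delta> * n)"
      unfolding Huge_def using \<delta> n by (intro few_of_large_degree[OF G edges]) auto
    then have Huge_le: "real (card Huge) \<le> 2 * M / \<delta>" using n by (simp add: field_simps)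
    \<comment> \<open>There are at most \<open>2 ^ card Huge\<close> rare traces, each with at most \<open>D\<close> vertices.\<close>
    have "real (card Z) \<le> (\<Sum>P\<in>Pow Huge - \<H>. real (card (cls P)))"
      unfolding Z_def using card_UN_le[of "Pow Huge - \<H>" cls] finHuge by (simp flip: of_nat_sum)
    also have "\<dots> \<le> (\<Sum>P\<in>Pow Huge - \<H>. D)" by (rule sum_mono) (auto simp: \<H>_def)
    also have "\<dots> \<le> (\<Sum>P\<in>Pow Huge. D)" using finHuge D0 by (intro sum_mono2) auto
    also have "\<dots> = 2 powr real (card Huge) * D" using finHuge by (simp add: card_Pow powr_realpow)
    also have "\<dots> \<le> 2 powr (2 * M / \<delta>) * D" using D0 Huge_le by (intro mult_right_mono powr_mono) auto
    also have "\<dots> \<le> \<eta> * n" using rare by (simp add: D_def)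
    finally have Z: "real (card Z) \<le> \<eta> * n" .
    have "R \<subseteq> verts G" by (auto simp: R_def Low_def)
    then have "card (verts G - R) = card (verts G) - card R" "card R \<le> card (verts G)"
      using fin finR by (auto simp: card_Diff_subset intro: card_mono)
    then have "real (card (verts G - R)) = n - real (card R)" by (simp add: n_def)
    then show ?thesis using split X Y Z by (simp add: algebra_simps)
  qed
  have q: "0 < 1 - 3 * \<eta>" using \<eta> by simp
  have R0: "0 < real (card R)" using R_large q n mult_pos_pos[of "1 - 3 * \<eta>" n] by linarith

  define y where "y P = real (card (cls P)) / real (card R)" for P
  \<comment> \<open>Sums over traces, weighted by frequency, are sums over the remaining vertices.\<close>
  have group: "(\<Sum>P\<in>\<H>. g P * real (card (cls P))) = (\<Sum>u\<in>R. g (nbrs G u \<inter> Huge))" for g :: "nat set \<Rightarrow> real"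
  proof -
    have "(\<Sum>u\<in>R. g (nbrs G u \<inter> Huge)) =
        (\<Sum>P\<in>\<H>. \<Sum>u\<in>{u \<in> R. nbrs G u \<inter> Huge = P}. g (nbrs G u \<inter> Huge))"
      by (rule sum.group[symmetric]) (use finR fin\<H> in \<open>auto simp: R_def\<close>)
    also have "\<dots> = (\<Sum>P\<in>\<H>. g P * real (card (cls P)))"
      by (intro sum.cong) (auto simp: cls_R)
    finally show ?thesis ..
  qed
  have hyp: "hypergraph Huge \<H>"
    unfolding hypergraph_def using finHuge inter k by (fastforce simp: \<H>_def)
  have "(\<Sum>P\<in>\<H>. y P) = (\<Sum>P\<in>\<H>. 1 * real (card (cls P))) / real (card R)"
    by (simp add: y_def sum_divide_distrib)
  also have "\<dots> = 1" unfolding group using R0 by simp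
  finally have y1: "(\<Sum>P\<in>\<H>. y P) = 1" .
  have yx: "(\<Sum>P\<in>{P \<in> \<H>. x \<in> P}. y P) \<le> c / (1 - 3 * \<eta>)" if x: "x \<in> Huge" for x
  proof -
    have "(\<Sum>P\<in>{P \<in> \<H>. x \<in> P}. y P) = (\<Sum>P\<in>\<H>. (if x \<in> P then 1 else 0) * real (card (cls P))) / real (card R)"
      unfolding sum_divide_distrib y_def using fin\<H>
      by (intro sum.mono_neutral_cong_left) auto
    also have "\<dots> = real (card {u \<in> R. x \<in> nbrs G u}) / real (card R)"
      unfolding group using finR x by (simp add: sum.If_cases Int_def)
    also have "\<dots> \<le> (c * n) / real (card R)"
    proof -
      have "card {u \<in> R. x \<in> nbrs G u} \<le> degree G x"
        unfolding degree_eq_card_nbrs[OF G] using finite_nbrs[OF G] by (intro card_mono) (auto simp: nbrs_sym)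
      moreover have "real (degree G x) \<le> c * n" using x deg by (auto simp: Huge_def)
      ultimately show ?thesis by (intro divide_right_mono) auto
    qed
    also have "\<dots> \<le> (c * n) / ((1 - 3 * \<eta>) * n)"
      using R_large q n c R0 by (intro divide_left_mono) auto
    finally show ?thesis using n by simp
  qed
  have "feasible_weights Huge \<H> (c / (1 - 3 * \<eta>)) y"
    unfolding feasible_weights_def using y1 yx by (auto simp: y_def)
  then have "A_fun k (c / (1 - 3 * \<eta>)) \<le> ereal (\<Sum>P\<in>\<H>. real (card P) * y P)"
    using hyp inter c q by (intro A_fun_le_weights) (auto simp: k_intersecting_def)
  also have "(\<Sum>P\<in>\<H>. real (card P) * y P) = (\<Sum>u\<in>R. real (card (nbrs G u \<inter> Huge))) / real (card R)"
    by (simp add: y_def flip: sum_divide_distrib group[of "\<lambda>P. real (card P)"])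
  also have "(\<Sum>u\<in>R. real (card (nbrs G u \<inter> Huge))) = real (card (SIGMA u:R. nbrs G u \<inter> Huge))"
    using finR finHuge by (simp add: card_SigmaI)
  also have "card (SIGMA u:R. nbrs G u \<inter> Huge) \<le> card (edges G)"
  proof (rule card_inj_on_le[where f = "\<lambda>(u, x). {u, x}"])
    have "R \<inter> Huge = {}" using \<delta>(2) by (auto simp: R_def Low_def Huge_def)
    then show "inj_on (\<lambda>(u, x). {u, x}) (SIGMA u:R. nbrs G u \<inter> Huge)"
      by (auto simp: inj_on_def doubleton_eq_iff)
    show "(\<lambda>(u, x). {u, x}) ` (SIGMA u:R. nbrs G u \<inter> Huge) \<subseteq> edges G"
      by (auto simp: nbrs_def insert_commute)
  qed (rule finite_edges[OF G])
  finally have "A_fun k (c / (1 - 3 * \<eta>)) \<le> ereal (real (card (edges G)) / real (card R))"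
    using R0 by (simp add: divide_right_mono)
  also have "real (card (edges G)) / real (card R) \<le> (M * n) / ((1 - 3 * \<eta>) * n)"
    using edges R_large q n M R0 by (intro frac_le) auto
  finally show ?thesis using n by simp
qed

section \<open>Asymptotic bounds\<close>

lemma eventually_less_linear:
  fixes a K :: real
  assumes "0 < a"
  shows "\<forall>\<^sub>F n in sequentially. K < a * real n"
proof (rule eventually_sequentiallyI[of "nat \<lceil>K / a\<rceil> + 1"])
  fix n assume "nat \<lceil>K / a\<rceil> + 1 \<le> n"
  then have "K / a < real n" by linarith
  then show "K < a * real n" using assms by (simp add: field_simps)
qed

text \<open>
  Weights that are feasible for a smaller \<open>c'\<close> leave a linear amount of slack in the degrees, which
  absorbs the bounded errors of the blow-up.
\<close>
lemma ssat_upper_bound: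
  fixes c c' a :: real
  assumes c: "0 < c'" "c' < c" "c < 1" and A: "A_fun k c' < ereal a"
  shows "\<forall>\<^sub>F n in sequentially.
    ereal_of_enat (ssat (c * real n) n (complete_graph (k + 2))) / ereal (real n) \<le> ereal a"
proof -
  obtain V :: "nat set" and \<H> where V: "hypergraph V \<H>" "k_intersecting k \<H>" and "a_min V \<H> c' < ereal a"
    using A unfolding A_fun_def Inf_less_iff by blast
  then obtain y where y: "feasible_weights V \<H> c' y" "(\<Sum>H\<in>\<H>. real (card H) * y H) < a"
    unfolding a_min_def Inf_less_iff by auto
  define s where "s = (\<Sum>H\<in>\<H>. real (card H) * y H)"
  define K where "K = real (card (all_pairs V)) + (\<Sum>H\<in>\<H>. real (card H))"
  have "0 < a - s" "0 < c - c'" using y c by (auto simp: s_def)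
  then have "\<forall>\<^sub>F n in sequentially. K < (a - s) * real n \<and> real (card V + card \<H>) < (c - c') * real n
      \<and> real (card V) < 1 * real n"
    by (intro eventually_conj eventually_less_linear) auto
  then show ?thesis
  proof eventually_elim
    case (elim n)
    then have n: "0 < n" by (cases n) auto
    have "card V \<le> n" "real (card V + card \<H>) + c' * real n \<le> c * real n"
      using elim by (auto simp: algebra_simps)
    then obtain G :: "nat graph" where G: "simple_graph G" "card (verts G) = n"
        "real (max_degree G) \<le> c * real n" "semi_saturated (complete_graph (k + 2)) G"
        "real (card (edges G)) \<le> real n * s + K"
      using blow_up_of_clique[OF V y(1), of n "c * real n"] c unfolding s_def K_def by auto
    have "ssat (c * real n) n (complete_graph (k + 2)) \<le> enat (card (edges G))"
      unfolding ssat_def using G by (intro Inf_lower) blast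
    then have "ereal_of_enat (ssat (c * real n) n (complete_graph (k + 2))) \<le> ereal_of_enat (enat (card (edges G)))"
      by (simp only: ereal_of_enat_le_iff)
    also have "\<dots> \<le> ereal (a * real n)"
      using G(5) elim by (simp add: algebra_simps)
    finally have "ereal_of_enat (ssat (c * real n) n (complete_graph (k + 2))) / ereal (real n)
        \<le> ereal (a * real n) / ereal (real n)"
      using n by (intro ereal_divide_right_mono) auto
    then show ?case using n by simp
  qed
qed

text \<open>
  Pigeonhole: the bands of degrees between consecutive thresholds are disjoint, and the degrees
  add up to twice the number of edges.
\<close>
lemma scale_with_small_degree_sum:
  fixes \<delta> :: "nat \<Rightarrow> real"
  assumes G: "simple_graph G" and \<delta>: "decseq \<delta>" and J: "0 < J"
    and e: "2 * real (card (edges G)) \<le> real J * b"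
  shows "\<exists>j<J. (\<Sum>x\<in>{x \<in> verts G. \<delta> (Suc j) \<le> real (degree G x) \<and> real (degree G x) < \<delta> j}.
      real (degree G x)) \<le> b"
proof (rule ccontr)
  define B where "B j = {x \<in> verts G. \<delta> (Suc j) \<le> real (degree G x) \<and> real (degree G x) < \<delta> j}" for j
  assume "\<not> ?thesis"
  then have big: "b < (\<Sum>x\<in>B j. real (degree G x))" if "j < J" for j
    using that unfolding B_def by (meson not_le)
  have fin: "finite (verts G)" using G by (simp add: simple_graph_def)
  have disj: "B i \<inter> B j = {}" if "i < j" for i j
  proof -
    have "\<delta> j \<le> \<delta> (Suc i)" using \<delta> that by (simp add: decseq_def Suc_leI)
    then show ?thesis by (auto simp: B_def)
  qed
  have "real J * b = (\<Sum>j<J. b)" by simp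
  also have "\<dots> < (\<Sum>j<J. \<Sum>x\<in>B j. real (degree G x))"
    by (rule sum_strict_mono) (use big J in auto)
  also have "\<dots> = (\<Sum>x\<in>(\<Union>j<J. B j). real (degree G x))"
  proof (rule sum.UNION_disjoint[symmetric])
    show "\<forall>i\<in>{..<J}. \<forall>j\<in>{..<J}. i \<noteq> j \<longrightarrow> B i \<inter> B j = {}"
      using disj by (metis Int_commute nat_neq_iff)
  qed (use fin in \<open>auto simp: B_def\<close>)
  also have "\<dots> \<le> (\<Sum>x\<in>verts G. real (degree G x))"
    by (rule sum_mono2) (use fin in \<open>auto simp: B_def\<close>)
  also have "\<dots> = 2 * real (card (edges G))"
    using handshake[OF G] by (simp flip: of_nat_sum)
  finally show False using e by simp
qed

text \<open>
  The threshold between huge and medium degrees bounds the number of traces, and the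
  threshold between medium and small degrees has to be tiny compared with the reciprocal of that
  number. So a sequence of thresholds is fixed in advance, each far below the one before, and
  the pigeonhole principle selects two consecutive ones with few edges at the degrees in between.
  The number \<open>J\<close> of bands of degrees does not depend on \<open>n\<close>, so finitely many conditions on \<open>n\<close>
  suffice.
\<close>
lemma eventually_A_fun_le_of_sparse:
  fixes c M \<eta> :: real
  assumes k: "1 \<le> k" and c: "0 < c" and M: "0 \<le> M" and \<eta>: "0 < \<eta>" "3 * \<eta> < 1"
  shows "\<forall>\<^sub>F n in sequentially. \<forall>G :: nat graph.
    simple_graph G \<and> card (verts G) = n \<and> real (max_degree G) \<le> c * real n \<and>
    semi_saturated (complete_graph (k + 2)) G \<and> real (card (edges G)) \<le> M * real n \<longrightarrow>
    A_fun k (c / (1 - 3 * \<eta>)) \<le> ereal (M / (1 - 3 * \<eta>))"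
proof -
  \<comment> \<open>\<open>T\<close> is such that at most \<open>\<eta> * n\<close> degrees reach \<open>T\<close>. The summand 1 keeps it positive for \<open>M = 0\<close>.\<close>
  define T where "T = 2 * M / \<eta> + 1"
  define J where "J = nat \<lceil>2 * M / \<eta>\<rceil> + 1"
  have T: "0 < T" "2 * M \<le> \<eta> * T" using M \<eta> by (auto simp: T_def field_simps intro: add_nonneg_pos)
  have "2 * M / \<eta> \<le> real J" unfolding J_def by linarith
  then have J: "2 * M \<le> real J * \<eta>" using \<eta> by (simp add: field_simps)
  \<comment> \<open>The second argument of \<open>min\<close> makes \<open>\<delta>_gap\<close> hold, the first one makes the sequence decrease.\<close>
  define \<delta> where "\<delta> = rec_nat 1 (\<lambda>_ d. min d (\<eta> / (2 * (T * 2 powr (2 * M / d)))))"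
  have \<delta>_Suc: "\<delta> (Suc j) = min (\<delta> j) (\<eta> / (2 * (T * 2 powr (2 * M / \<delta> j))))" for j
    by (simp add: \<delta>_def)
  have \<delta>_pos: "0 < \<delta> j" for j
  proof (induction j)
    case 0
    then show ?case by (simp add: \<delta>_def)
  next
    case (Suc j)
    then show ?case using T \<eta> by (simp add: \<delta>_Suc)
  qed
  have \<delta>_dec: "decseq \<delta>" by (rule decseq_SucI) (simp add: \<delta>_Suc)
  have \<delta>_gap: "2 powr (2 * M / \<delta> j) * (T * \<delta> (Suc j)) \<le> \<eta> / 2" for j
  proof -
    have "\<delta> (Suc j) \<le> \<eta> / (2 * (T * 2 powr (2 * M / \<delta> j)))" by (simp add: \<delta>_Suc)
    then show ?thesis using T by (simp add: field_simps)
  qed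
  have "\<forall>\<^sub>F n in sequentially. \<forall>j\<in>{..<J}. T < \<delta> j * real n \<and>
      2 powr (2 * M / \<delta> j) * (T + 1) < \<eta> / 2 * real n"
    using \<delta>_pos \<eta> by (intro eventually_ball_finite ballI eventually_conj eventually_less_linear) auto
  then have "\<forall>\<^sub>F n in sequentially. 0 < n \<and> (\<forall>j\<in>{..<J}. T < \<delta> j * real n \<and>
      2 powr (2 * M / \<delta> j) * (T + 1) < \<eta> / 2 * real n)"
    by (intro eventually_conj eventually_gt_at_top)
  then show ?thesis
  proof eventually_elim
    case (elim n)
    show ?case
    proof (intro allI impI, elim conjE)
      fix G :: "nat graph"
      assume G: "simple_graph G" and n: "card (verts G) = n" and deg: "real (max_degree G) \<le> c * real n"
        and sat: "semi_saturated (complete_graph (k + 2)) G" and e: "real (card (edges G)) \<le> M * real n"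
      have dec: "decseq (\<lambda>j. \<delta> j * real n)"
        using \<delta>_dec by (auto simp: decseq_def intro: mult_right_mono)
      have "2 * real (card (edges G)) \<le> 2 * M * real n" using e by simp
      also have "\<dots> \<le> real J * \<eta> * real n" using J by (intro mult_right_mono) auto
      finally have "2 * real (card (edges G)) \<le> real J * (\<eta> * real n)" by (simp add: mult.assoc)
      from scale_with_small_degree_sum[OF G dec _ this]
      obtain j where j: "j < J" and med: "(\<Sum>x\<in>{x \<in> verts G. \<delta> (Suc j) * real n \<le> real (degree G x) \<and>
          real (degree G x) < \<delta> j * real n}. real (degree G x)) \<le> \<eta> * real n"
        by (auto simp: J_def)
      have "2 powr (2 * M / \<delta> j) * (T * \<delta> (Suc j)) * real n \<le> \<eta> / 2 * real n"
        using \<delta>_gap by (intro mult_right_mono) auto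
      moreover have "2 powr (2 * M / \<delta> j) * (T + 1) < \<eta> / 2 * real n" using elim j by auto
      ultimately have rare: "2 powr (2 * M / \<delta> j) * (T * (\<delta> (Suc j) * real n) + T + 1) \<le> \<eta> * real n"
        by (simp add: algebra_simps)
      show "A_fun k (c / (1 - 3 * \<eta>)) \<le> ereal (M / (1 - 3 * \<eta>))"
      proof (rule A_fun_le_of_sparse_graph[where G = G and T = T and \<delta> = "\<delta> j" and \<delta>' = "\<delta> (Suc j)"])
        fix u v assume "u \<in> verts G" "v \<in> verts G" "u \<noteq> v" "u \<notin> nbrs G v"
        from common_nbrs_of_semi_saturated[OF G sat this]
        show "k \<le> card (nbrs G u \<inter> nbrs G v)" by simp
      next
        fix v assume "v \<in> verts G"
        then have "real (degree G v) \<le> real (max_degree G)" using degree_le_max_degree[OF G] by simp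
        then show "real (degree G v) \<le> c * real (card (verts G))" using deg n by simp
      qed (use G n k c e M \<eta> T \<delta>_pos med rare elim j in auto)
    qed
  qed
qed

lemma ssat_lower_bound:
  fixes c M \<eta> :: real
  assumes k: "1 \<le> k" and c: "0 < c" and M: "0 \<le> M" and \<eta>: "0 < \<eta>" "3 * \<eta> < 1"
    and A: "ereal (M / (1 - 3 * \<eta>)) < A_fun k (c / (1 - 3 * \<eta>))"
  shows "\<forall>\<^sub>F n in sequentially. ereal M \<le>
    ereal_of_enat (ssat (c * real n) n (complete_graph (k + 2))) / ereal (real n)"
  using eventually_A_fun_le_of_sparse[OF k c M \<eta>] eventually_gt_at_top[of 0]
proof eventually_elim
  case (elim n)
  \<comment> \<open>The infimum is over extended natural numbers, so it is compared with an integer bound.\<close>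
  define q where "q = nat \<lceil>M * real n\<rceil>"
  have q: "M * real n \<le> real q" unfolding q_def by linarith
  have "enat q \<le> ssat (c * real n) n (complete_graph (k + 2))"
    unfolding ssat_def
  proof (rule Inf_greatest, clarify)
    fix V :: "nat set" and E
    assume *: "simple_graph (V, E)" "n = card (verts (V, E))" "semi_saturated (complete_graph (k + 2)) (V, E)"
      "real (max_degree (V, E)) \<le> c * real (card (verts (V, E)))"
    have "M * real n < real (card (edges (V, E)))"
    proof (rule ccontr)
      assume "\<not> ?thesis"
      then have "A_fun k (c / (1 - 3 * \<eta>)) \<le> ereal (M / (1 - 3 * \<eta>))"
        using elim(1)[rule_format, of "(V, E)"] * by simp
      then show False using A by simp
    qed
    then show "enat q \<le> enat (card (edges (V, E)))" unfolding q_def by (simp add: nat_le_iff ceiling_le_iff)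
  qed
  then have "ereal_of_enat (enat q) \<le> ereal_of_enat (ssat (c * real n) n (complete_graph (k + 2)))"
    by (simp only: ereal_of_enat_le_iff)
  then have "ereal (M * real n) \<le> ereal_of_enat (ssat (c * real n) n (complete_graph (k + 2)))"
    using q by (auto intro: order_trans[rotated])
  then have "ereal (M * real n) / ereal (real n) \<le>
      ereal_of_enat (ssat (c * real n) n (complete_graph (k + 2))) / ereal (real n)"
    using elim(2) by (intro ereal_divide_right_mono) auto
  then show ?case using elim(2) by simp
qed

theorem theorem1p4:
  fixes r :: nat and c :: real
  assumes "4 \<le> r" and "0 < c" and "c < 1"
    and "isCont (A_fun (r - 2)) c"
  shows "(\<lambda>n :: nat. ereal_of_enat (ssat (c * real n) n (complete_graph r)) / ereal (real n))
           \<longlonglongrightarrow> A_fun (r - 2) c"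
proof (rule order_tendstoI)
  define k where "k = r - 2"
  have k: "1 \<le> k" "r = k + 2" "r - 2 = k" using assms(1) by (auto simp: k_def)
  note cont = assms(4)[unfolded k(3)]
  fix a assume a: "a < A_fun (r - 2) c"
  have nonneg: "0 \<le> ereal_of_enat (ssat (c * real n) n (complete_graph r)) / ereal (real n)" for n
    by (cases "n = 0") auto
  show "\<forall>\<^sub>F n in sequentially. a < ereal_of_enat (ssat (c * real n) n (complete_graph r)) / ereal (real n)"
  proof (cases "a < 0")
    case True
    then show ?thesis using nonneg by (intro always_eventually allI) (rule less_le_trans)
  next
    case False
    \<comment> \<open>\<open>M'\<close> separates \<open>M / (1 - 3 * \<eta>)\<close> from the value of \<open>A_fun k\<close> at \<open>c / (1 - 3 * \<eta>)\<close> for small \<open>\<eta>\<close>.\<close>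
    obtain M where M: "a < ereal M" "ereal M < A_fun k c" using ereal_dense2[OF a] k by auto
    obtain M' where M': "M < M'" "ereal M' < A_fun k c" using ereal_dense2[OF M(2)] by auto
    have M0: "0 \<le> M" using False M(1) by (cases a) auto
    have lim: "((\<lambda>\<eta>. x / (1 - 3 * \<eta>)) \<longlongrightarrow> x) (at_right 0)" for x :: real
      by (auto intro!: tendsto_eq_intros)
    have "\<forall>\<^sub>F \<eta> in at_right 0. ereal M' < A_fun k (c / (1 - 3 * \<eta>))"
      using order_tendstoD(1)[OF isCont_tendsto_compose[OF cont lim] M'(2)] .
    moreover have "\<forall>\<^sub>F \<eta> in at_right 0. M / (1 - 3 * \<eta>) < M'"
      using order_tendstoD(2)[OF lim M'(1)] .
    moreover have "\<forall>\<^sub>F \<eta> in at_right (0::real). 0 < \<eta> \<and> 3 * \<eta> < 1"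
      by (subst eventually_at_right[of 0 1]) (auto intro!: exI[of _ "1/3"])
    ultimately have "\<forall>\<^sub>F \<eta> in at_right (0::real). 0 < \<eta> \<and> 3 * \<eta> < 1 \<and>
        ereal (M / (1 - 3 * \<eta>)) < A_fun k (c / (1 - 3 * \<eta>))"
      by eventually_elim (auto intro: less_trans[of _ "ereal M'"])
    then obtain \<eta> where \<eta>: "0 < \<eta>" "3 * \<eta> < 1" "ereal (M / (1 - 3 * \<eta>)) < A_fun k (c / (1 - 3 * \<eta>))"
      using eventually_happens[of _ "at_right (0::real)"] by auto
    show ?thesis
      using ssat_lower_bound[OF k(1) assms(2) M0 \<eta>] unfolding k(2)
      by eventually_elim (rule less_le_trans[OF M(1)])
  qed
next
  define k where "k = r - 2"
  have k: "r = k + 2" "r - 2 = k" using assms(1) by (auto simp: k_def)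
  note cont = assms(4)[unfolded k(2)]
  fix a assume a: "A_fun (r - 2) c < a"
  obtain a' where a': "A_fun k c < ereal a'" "ereal a' < a" using ereal_dense2[OF a] k by auto
  have "(A_fun k \<longlongrightarrow> A_fun k c) (at_left c)"
    using cont filterlim_at_split unfolding isCont_def by blast
  then have "\<forall>\<^sub>F c' in at_left c. A_fun k c' < ereal a'" using a'(1) by (rule order_tendstoD)
  moreover have "\<forall>\<^sub>F c' in at_left c. 0 < c' \<and> c' < c"
    using assms(2) by (subst eventually_at_left[of 0]) auto
  ultimately have "\<forall>\<^sub>F c' in at_left c. 0 < c' \<and> c' < c \<and> A_fun k c' < ereal a'"
    by eventually_elim auto
  then obtain c' where "0 < c'" "c' < c" "A_fun k c' < ereal a'"
    using eventually_happens[of _ "at_left c"] by auto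
  from ssat_upper_bound[OF this(1,2) assms(3) this(3)]
  show "\<forall>\<^sub>F n in sequentially. ereal_of_enat (ssat (c * real n) n (complete_graph r)) / ereal (real n) < a"
    unfolding k(1) by eventually_elim (rule le_less_trans[OF _ a'(2)])
qed

end
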